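(* Let $I\subseteq\mathbb{R}$ be an open invex subset with respect to $\eta:I\times I\to\mathbb{R}_+$, let $f:I\to\mathbb{R}$ be an absolutely continuous mapping on $I$, and let $a,b\in I$ with $\eta(b,a)\neq 0$. Let $q>1$ be fixed and $p=\frac{q}{q-1}$. If $|f'|^q$ is preinvex on $I$ with respect to $\eta$, then $$\left|\frac{1}{6}\left[f(a)+4f\left(\frac{2a+\eta(b,a)}{2}\right)+f(a+\eta(b,a))\right]-\frac{1}{\eta(b,a)}\int_a^{a+\eta(b,a)}f(x)\,dx\right|$$ $$\le\eta(b,a)\left(\frac{1+2^{p+1}}{6^{p+1}(p+1)}\right)^{\frac1p}\left\{\left(\frac38|f'(a)|^q+\frac18|f'(b)|^q\right)^{\frac1q}+\left(\frac18|f'(a)|^q+\frac38|f'(b)|^q\right)^{\frac1q}\right\}.$$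
   Context: $\mathbb{R}_+=[0,\infty)$. A set $I\subseteq\mathbb{R}$ is invex with respect to $\eta:I\times I\to\mathbb{R}_+$ if $u+t\,\eta(v,u)\in I$ for all $u,v\in I$ and all $t\in[0,1]$. A function $g:I\to\mathbb{R}$ on an invex set $I$ is preinvex with respect to $\eta$ if $g(u+t\,\eta(v,u))\le(1-t)g(u)+t\,g(v)$ for all $u,v\in I$, $t\in[0,1]$. $f'$ is the derivative of $f$; the hypothesis that $|f'|^q$ is preinvex on $I$ presupposes that $f'(x)$ exists at every $x\in I$. *)

theory Defs
  imports "HOL-Analysis.Analysis"
begin

definition invex_wrt :: "real set \<Rightarrow> (real \<Rightarrow> real \<Rightarrow> real) \<Rightarrow> bool" where
  "invex_wrt I \<eta> \<longleftrightarrow>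
     (\<forall>u\<in>I. \<forall>v\<in>I. 0 \<le> \<eta> v u) \<and>
     (\<forall>u\<in>I. \<forall>v\<in>I. \<forall>t\<in>{0..1}. u + t * \<eta> v u \<in> I)"

definition preinvex_on :: "real set \<Rightarrow> (real \<Rightarrow> real \<Rightarrow> real) \<Rightarrow> (real \<Rightarrow> real) \<Rightarrow> bool" where
  "preinvex_on I \<eta> g \<longleftrightarrow>
     invex_wrt I \<eta> \<and>
     (\<forall>u\<in>I. \<forall>v\<in>I. \<forall>t\<in>{0..1}. g (u + t * \<eta> v u) \<le> (1 - t) * g u + t * g v)"

text \<open>
  Absolute continuity of a real function in the epsilon-delta sense, tested on finite families of
  non-overlapping compact intervals. The set \<open>I\<close> need not be an interval: the test intervals
  are required to lie inside \<open>I\<close>, and \<open>f\<close> is not constrained across gaps of \<open>I\<close>. (The library's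
  \<open>absolutely_continuous\<close> is the unrelated notion for measures.)
\<close>
definition abs_continuous_on :: "real set \<Rightarrow> (real \<Rightarrow> real) \<Rightarrow> bool" where
  "abs_continuous_on I f \<longleftrightarrow>
     (\<forall>\<epsilon>>0. \<exists>\<delta>>0. \<forall>(n::nat) (x::nat \<Rightarrow> real) (y::nat \<Rightarrow> real).
        (\<forall>i<n. x i \<le> y i \<and> {x i..y i} \<subseteq> I) \<longrightarrow>
        (\<forall>i<n. \<forall>j<n. i \<noteq> j \<longrightarrow> {x i<..<y i} \<inter> {x j<..<y j} = {}) \<longrightarrow>
        (\<Sum>i<n. y i - x i) < \<delta> \<longrightarrow>
        (\<Sum>i<n. \<bar>f (y i) - f (x i)\<bar>) < \<epsilon>)"

end

theory Submission
  imports Defs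
begin

text \<open>
  Put \<open>h = \<eta> b a\<close>, which is positive, and \<open>m = a + h / 2\<close>. Integration by parts on each half of
  \<open>{a..a + h}\<close>, against the piecewise linear kernel that equals \<open>x - (a + h / 6)\<close> on \<open>{a..m}\<close> and
  \<open>x - (a + 5 * h / 6)\<close> on \<open>{m..a + h}\<close>, turns the integral of kernel times \<open>f'\<close> into exactly
  \<open>h\<close> times the error of Simpson's rule: the offsets \<open>h / 6\<close> and \<open>h / 3\<close> of the two zeros from the
  nodes produce the weights \<open>1 / 6\<close>, \<open>4 / 6\<close>, \<open>1 / 6\<close>.

  Preinvexity bounds \<open>\<bar>f'\<bar> powr q\<close> on \<open>{a..a + h}\<close> by the affine function that runs from
  \<open>\<bar>f' a\<bar> powr q\<close> to \<open>\<bar>f' b\<bar> powr q\<close>. Hoelder's inequality on each half then separates the kernel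
  from this affine majorant, and both factors integrate in closed form.

  The majorant is inserted before Hoelder's inequality is applied, so the functions to be separated
  are continuous. The integral of kernel times \<open>f'\<close> exists as a gauge integral, by the
  fundamental theorem of calculus, which that integral satisfies for every derivative. The estimate
  on one half is \<open>corrected_quadrature_error_le\<close>, stated for an arbitrary continuous majorant and an
  arbitrary zero of the kernel; \<open>Simpson_error_le_affine_bound\<close> adds two instances of it.
\<close>

section \<open>Hoelder's inequality for continuous functions\<close>

text \<open>
  After division by the two norms, Young's inequality holds pointwise and integrates to
  \<open>1 / p + 1 / q = 1\<close>. If one of the norms vanishes, continuity makes the corresponding function
  vanish identically.
\<close>

lemma Hoelder_inequality_continuous:
  fixes u v :: "real \<Rightarrow> real"
  assumes cd: "c < d" and p: "p > 1" and q: "q > 1" and pq: "1 / p + 1 / q = 1"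
    and u: "continuous_on {c..d} u" "\<And>x. x \<in> {c..d} \<Longrightarrow> u x \<ge> 0"
    and v: "continuous_on {c..d} v" "\<And>x. x \<in> {c..d} \<Longrightarrow> v x \<ge> 0"
  shows "integral {c..d} (\<lambda>x. u x * v x)
    \<le> integral {c..d} (\<lambda>x. u x powr p) powr (1 / p) * integral {c..d} (\<lambda>x. v x powr q) powr (1 / q)"
proof -
  define P where "P = integral {c..d} (\<lambda>x. u x powr p)"
  define Q where "Q = integral {c..d} (\<lambda>x. v x powr q)"
  have cu: "continuous_on {c..d} (\<lambda>x. u x powr p)"
    using p u by (intro continuous_on_powr' continuous_on_const) auto
  have cv: "continuous_on {c..d} (\<lambda>x. v x powr q)"
    using q v by (intro continuous_on_powr' continuous_on_const) auto
  have cuv: "continuous_on {c..d} (\<lambda>x. u x * v x)"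
    using u v by (intro continuous_on_mult) auto
  have P0: "P \<ge> 0" and Q0: "Q \<ge> 0"
    unfolding P_def Q_def by (auto intro!: integral_nonneg integrable_continuous_interval cu cv)
  show ?thesis
  proof (cases "P = 0 \<or> Q = 0")
    case True
    have "u x * v x = 0" if "x \<in> {c..d}" for x
    proof -
      have "u x powr p = 0" if "P = 0"
        using integral_eq_0_iff[OF cu cd] that \<open>x \<in> {c..d}\<close> by (auto simp: P_def)
      moreover have "v x powr q = 0" if "Q = 0"
        using integral_eq_0_iff[OF cv cd] that \<open>x \<in> {c..d}\<close> by (auto simp: Q_def)
      ultimately show ?thesis using True by auto
    qed
    then have "integral {c..d} (\<lambda>x. u x * v x) = integral {c..d} (\<lambda>x. 0)"
      by (intro Henstock_Kurzweil_Integration.integral_cong) auto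
    then show ?thesis by simp
  next
    case False
    then have P: "P > 0" and Q: "Q > 0" using P0 Q0 by auto
    define \<alpha> where "\<alpha> = P powr (1 / p)"
    define \<beta> where "\<beta> = Q powr (1 / q)"
    have \<alpha>: "\<alpha> > 0" "\<alpha> powr p = P" and \<beta>: "\<beta> > 0" "\<beta> powr q = Q"
      using P Q p q by (auto simp: \<alpha>_def \<beta>_def powr_powr)
    have "integral {c..d} (\<lambda>x. u x * v x)
        \<le> integral {c..d} (\<lambda>x. \<alpha> * \<beta> * (u x powr p / (p * P) + v x powr q / (q * Q)))"
    proof (rule integral_le)
      show "(\<lambda>x. \<alpha> * \<beta> * (u x powr p / (p * P) + v x powr q / (q * Q))) integrable_on {c..d}"
        using P Q p q
        by (intro integrable_continuous_interval continuous_on_mult continuous_on_add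
            continuous_on_divide continuous_on_const cu cv) auto
      fix x assume x: "x \<in> {c..d}"
      have "(u x / \<alpha>) * (v x / \<beta>) \<le> (u x / \<alpha>) powr p / p + (v x / \<beta>) powr q / q"
        using \<alpha>(1) \<beta>(1) u(2)[OF x] v(2)[OF x] by (intro Youngs_inequality p q pq) simp_all
      also have "\<dots> = u x powr p / (p * P) + v x powr q / (q * Q)"
        using x u v \<alpha> \<beta> by (simp add: powr_divide mult.commute)
      finally show "u x * v x \<le> \<alpha> * \<beta> * (u x powr p / (p * P) + v x powr q / (q * Q))"
        using \<alpha>(1) \<beta>(1) by (simp add: field_simps)
    qed (intro integrable_continuous_interval cuv)
    also have "\<dots> = \<alpha> * \<beta> * (P / (p * P) + Q / (q * Q))"
      using P Q p q unfolding P_def Q_def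
      by (subst Henstock_Kurzweil_Integration.integral_mult_right,
          subst Henstock_Kurzweil_Integration.integral_add)
        (auto intro!: integrable_continuous_interval continuous_intros cu cv
           simp: P_def[symmetric] Q_def[symmetric])
    also have "\<dots> = \<alpha> * \<beta>"
      using P Q pq by simp
    finally show ?thesis
      by (simp add: \<alpha>_def \<beta>_def P_def Q_def)
  qed
qed

section \<open>A linear kernel on one interval\<close>

lemma has_integral_abs_diff_powr:
  fixes c d s r :: real
  assumes "c \<le> s" "s \<le> d" "r > 0"
  shows "((\<lambda>x. \<bar>x - s\<bar> powr r) has_integral
           ((s - c) powr (r + 1) + (d - s) powr (r + 1)) / (r + 1)) {c..d}"
proof -
  have "((\<lambda>x. \<bar>x - s\<bar> powr r) has_integral
      - ((s - s) powr (r + 1) / (r + 1)) - - ((s - c) powr (r + 1) / (r + 1))) {c..s}"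
    using assms
    by (intro fundamental_theorem_of_calculus_interior)
      (auto simp: has_real_derivative_iff_has_vector_derivative[symmetric]
        intro!: derivative_eq_intros continuous_intros continuous_on_powr')
  moreover have "((\<lambda>x. \<bar>x - s\<bar> powr r) has_integral
      (d - s) powr (r + 1) / (r + 1) - (s - s) powr (r + 1) / (r + 1)) {s..d}"
    using assms
    by (intro fundamental_theorem_of_calculus_interior)
      (auto simp: has_real_derivative_iff_has_vector_derivative[symmetric]
        intro!: derivative_eq_intros continuous_intros continuous_on_powr')
  ultimately have "((\<lambda>x. \<bar>x - s\<bar> powr r) has_integral
      - ((s - s) powr (r + 1) / (r + 1)) - - ((s - c) powr (r + 1) / (r + 1))
      + ((d - s) powr (r + 1) / (r + 1) - (s - s) powr (r + 1) / (r + 1))) {c..d}"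
    by (rule has_integral_combine[OF assms(1,2)])
  then show ?thesis
    by (simp add: add_divide_distrib)
qed

text \<open>
  By integration by parts, the quantity estimated is the integral of \<open>(x - s) * f' x\<close> over \<open>{c..d}\<close>:
  the zero \<open>s\<close> of the kernel distributes the length of the interval as weights on the two ends. The
  right-hand side is Hoelder's bound for \<open>\<bar>x - s\<bar>\<close> and \<open>\<phi> x powr (1 / q)\<close>.
\<close>

lemma corrected_quadrature_error_le:
  fixes f f' \<phi> :: "real \<Rightarrow> real"
  assumes cd: "c < d" and s: "c \<le> s" "s \<le> d"
    and p: "p > 1" and q: "q > 1" and pq: "1 / p + 1 / q = 1"
    and f': "\<And>x. x \<in> {c..d} \<Longrightarrow> (f has_real_derivative f' x) (at x within {c..d})"
    and \<phi>: "continuous_on {c..d} \<phi>" "\<And>x. x \<in> {c..d} \<Longrightarrow> \<bar>f' x\<bar> powr q \<le> \<phi> x"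
  shows "\<bar>(d - s) * f d + (s - c) * f c - integral {c..d} f\<bar>
    \<le> (((s - c) powr (p + 1) + (d - s) powr (p + 1)) / (p + 1)) powr (1 / p)
       * integral {c..d} \<phi> powr (1 / q)"
proof -
  have \<phi>0: "\<phi> x \<ge> 0" if "x \<in> {c..d}" for x
    using \<phi>(2)[OF that] powr_ge_zero order_trans by blast
  have c\<phi>: "continuous_on {c..d} (\<lambda>x. \<phi> x powr (1 / q))"
    using q \<phi> \<phi>0 by (intro continuous_on_powr' continuous_on_const) auto
  have "continuous_on {c..d} f"
    using f' by (intro DERIV_continuous_on)
  then have If: "(f has_integral integral {c..d} f) {c..d}"
    by (intro integrable_integral integrable_continuous_interval)
  have "((\<lambda>x. f x + (x - s) * f' x) has_integral (d - s) * f d - (c - s) * f c) {c..d}"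
    using cd f'
    by (intro fundamental_theorem_of_calculus)
      (auto simp: has_real_derivative_iff_has_vector_derivative[symmetric]
        intro!: derivative_eq_intros)
  from has_integral_diff[OF this If]
  have I: "((\<lambda>x. (x - s) * f' x) has_integral
      (d - s) * f d + (s - c) * f c - integral {c..d} f) {c..d}"
    by (simp add: algebra_simps)
  have "\<bar>(d - s) * f d + (s - c) * f c - integral {c..d} f\<bar>
      = norm (integral {c..d} (\<lambda>x. (x - s) * f' x))"
    using I by (simp add: integral_unique)
  also have "\<dots> \<le> integral {c..d} (\<lambda>x. \<bar>x - s\<bar> * \<phi> x powr (1 / q))"
  proof (rule integral_norm_bound_integral)
    show "(\<lambda>x. (x - s) * f' x) integrable_on {c..d}"
      using I by blast
    show "(\<lambda>x. \<bar>x - s\<bar> * \<phi> x powr (1 / q)) integrable_on {c..d}"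
      by (intro integrable_continuous_interval continuous_intros c\<phi>)
    fix x assume x: "x \<in> {c..d}"
    have "(\<bar>f' x\<bar> powr q) powr (1 / q) \<le> \<phi> x powr (1 / q)"
      using q \<phi>(2)[OF x] by (intro powr_mono2) auto
    then have "\<bar>f' x\<bar> \<le> \<phi> x powr (1 / q)"
      using q by (simp add: powr_powr)
    then show "norm ((x - s) * f' x) \<le> \<bar>x - s\<bar> * \<phi> x powr (1 / q)"
      by (simp add: abs_mult mult_left_mono)
  qed
  also have "\<dots> \<le> integral {c..d} (\<lambda>x. \<bar>x - s\<bar> powr p) powr (1 / p)
      * integral {c..d} (\<lambda>x. (\<phi> x powr (1 / q)) powr q) powr (1 / q)"
    by (intro Hoelder_inequality_continuous cd p q pq continuous_intros c\<phi>) auto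
  also have "integral {c..d} (\<lambda>x. (\<phi> x powr (1 / q)) powr q) = integral {c..d} \<phi>"
    using q \<phi>0 by (intro Henstock_Kurzweil_Integration.integral_cong) (auto simp: powr_powr)
  also have "integral {c..d} (\<lambda>x. \<bar>x - s\<bar> powr p)
      = ((s - c) powr (p + 1) + (d - s) powr (p + 1)) / (p + 1)"
    using p by (intro integral_unique has_integral_abs_diff_powr s) auto
  finally show ?thesis .
qed

section \<open>Simpson's rule\<close>

lemma preinvex_on_le_affine:
  assumes "preinvex_on I \<eta> g" "a \<in> I" "b \<in> I" "\<eta> b a > 0" "x \<in> {a..a + \<eta> b a}"
  shows "x \<in> I" and "g x \<le> g a + (g b - g a) / \<eta> b a * (x - a)"
proof -
  define t where "t = (x - a) / \<eta> b a"
  have t: "t \<in> {0..1}" and x: "x = a + t * \<eta> b a"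
    using assms(4,5) by (auto simp: t_def field_simps)
  show "x \<in> I"
    using assms t unfolding x preinvex_on_def invex_wrt_def by blast
  have "g x \<le> (1 - t) * g a + t * g b"
    using assms t unfolding x preinvex_on_def by blast
  then show "g x \<le> g a + (g b - g a) / \<eta> b a * (x - a)"
    by (simp add: t_def algebra_simps diff_divide_distrib)
qed

lemma integral_affine_interval:
  fixes c d :: real
  assumes "c \<le> d"
  shows "integral {c..d} (\<lambda>x. A + k * (x - a)) = (d - c) * (A + k * ((c + d) / 2 - a))"
proof -
  have "((\<lambda>x. A + k * (x - a)) has_integral
      (A * d + k * (d - a)\<^sup>2 / 2) - (A * c + k * (c - a)\<^sup>2 / 2)) {c..d}"
    using assms
    by (intro fundamental_theorem_of_calculus)
      (auto simp: has_real_derivative_iff_has_vector_derivative[symmetric]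
        intro!: derivative_eq_intros)
  also have "(A * d + k * (d - a)\<^sup>2 / 2) - (A * c + k * (c - a)\<^sup>2 / 2)
      = (d - c) * (A + k * ((c + d) / 2 - a))"
    by (simp add: power2_eq_square field_simps)
  finally show ?thesis by (rule integral_unique)
qed

text \<open>
  Only the majorant of \<open>\<bar>f'\<bar> powr q\<close> enters the estimate, so it is stated for a derivative dominated
  by any affine function; \<open>A\<close> and \<open>B\<close> are the values of that function at the two ends.
\<close>

lemma Simpson_error_le_affine_bound:
  fixes f f' :: "real \<Rightarrow> real"
  assumes h: "h > 0" and p: "p > 1" and q: "q > 1" and pq: "1 / p + 1 / q = 1"
    and AB: "A \<ge> 0" "B \<ge> 0"
    and deriv: "\<And>x. x \<in> {a..a + h} \<Longrightarrow> (f has_real_derivative f' x) (at x within {a..a + h})"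
    and le: "\<And>x. x \<in> {a..a + h} \<Longrightarrow> \<bar>f' x\<bar> powr q \<le> A + (B - A) / h * (x - a)"
  shows "\<bar>1 / 6 * (f a + 4 * f (a + h / 2) + f (a + h)) - 1 / h * integral {a..a + h} f\<bar>
    \<le> h * ((1 + 2 powr (p + 1)) / (6 powr (p + 1) * (p + 1))) powr (1 / p)
       * ((3 / 8 * A + 1 / 8 * B) powr (1 / q) + (1 / 8 * A + 3 / 8 * B) powr (1 / q))"
proof -
  define m where "m = a + h / 2"
  define K where "K = (1 + 2 powr (p + 1)) / (6 powr (p + 1) * (p + 1))"
  define \<phi> where "\<phi> = (\<lambda>x. A + (B - A) / h * (x - a))"
  have f': "(f has_real_derivative f' x) (at x within S)"
    if "x \<in> {a..a + h}" "S \<subseteq> {a..a + h}" for x S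
    using deriv that DERIV_subset by blast
  have bound: "\<bar>f' x\<bar> powr q \<le> \<phi> x" if "x \<in> {a..a + h}" for x
    using le that by (simp add: \<phi>_def)
  have c\<phi>: "continuous_on S \<phi>" for S
    using h unfolding \<phi>_def by (intro continuous_intros) auto

  \<comment> \<open>Both kernels have their zero at distance \<open>h / 6\<close> from one end of their half and \<open>h / 3\<close> from the
    other. The powers of \<open>h\<close> collect to \<open>h\<^sup>2\<close> because \<open>(p + 1) / p + 1 / q = 2\<close>.\<close>
  have kernel: "((h / 6) powr (p + 1) + (h / 3) powr (p + 1)) / (p + 1) = h powr (p + 1) * K"
  proof -
    have "(h / 3) powr (p + 1) = (h / 6 * 2) powr (p + 1)" by simp
    also have "\<dots> = (h / 6) powr (p + 1) * 2 powr (p + 1)" using h by (simp only: powr_mult)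
    finally show ?thesis
      using h by (simp add: K_def powr_divide field_simps)
  qed
  have scale: "(h powr (p + 1) * K) powr (1 / p) * (h * X) powr (1 / q)
      = h\<^sup>2 * (K powr (1 / p) * X powr (1 / q))" if "X \<ge> 0" for X
  proof -
    have "(p + 1) / p + 1 / q = 2"
      using pq p by (simp add: add_divide_distrib)
    then have "h powr ((p + 1) / p) * h powr (1 / q) = h\<^sup>2"
      using h by (simp flip: powr_add)
    moreover have "K \<ge> 0" using p by (simp add: K_def)
    ultimately show ?thesis
      using h that by (simp add: powr_mult powr_powr)
  qed

  have left: "\<bar>h / 3 * f m + h / 6 * f a - integral {a..m} f\<bar>
      \<le> h\<^sup>2 * (K powr (1 / p) * (3 / 8 * A + 1 / 8 * B) powr (1 / q))"
  proof -
    have "integral {a..m} \<phi> = h * (3 / 8 * A + 1 / 8 * B)"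
      using h unfolding \<phi>_def m_def by (subst integral_affine_interval) (auto simp: field_simps)
    moreover have "\<bar>(m - (a + h / 6)) * f m + ((a + h / 6) - a) * f a - integral {a..m} f\<bar>
      \<le> ((((a + h / 6) - a) powr (p + 1) + (m - (a + h / 6)) powr (p + 1)) / (p + 1)) powr (1 / p)
        * integral {a..m} \<phi> powr (1 / q)"
      using h p q pq f' bound c\<phi>
      by (intro corrected_quadrature_error_le[where f' = f']) (auto simp: m_def)
    moreover have "m - (a + h / 6) = h / 3" "(a + h / 6) - a = h / 6"
      by (simp_all add: m_def)
    ultimately show ?thesis
      using AB by (simp only: kernel scale)
  qed
  have right: "\<bar>h / 6 * f (a + h) + h / 3 * f m - integral {m..a + h} f\<bar>
      \<le> h\<^sup>2 * (K powr (1 / p) * (1 / 8 * A + 3 / 8 * B) powr (1 / q))"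
  proof -
    let ?s = "a + 5 * h / 6"
    have "integral {m..a + h} \<phi> = h * (1 / 8 * A + 3 / 8 * B)"
      using h unfolding \<phi>_def m_def by (subst integral_affine_interval) (auto simp: field_simps)
    moreover have "\<bar>(a + h - ?s) * f (a + h) + (?s - m) * f m - integral {m..a + h} f\<bar>
      \<le> (((?s - m) powr (p + 1) + (a + h - ?s) powr (p + 1)) / (p + 1)) powr (1 / p)
        * integral {m..a + h} \<phi> powr (1 / q)"
      using h p q pq f' bound c\<phi>
      by (intro corrected_quadrature_error_le[where f' = f']) (auto simp: m_def)
    moreover have "a + h - ?s = h / 6" "?s - m = h / 3"
      by (simp_all add: m_def)
    ultimately show ?thesis
      using AB by (simp only: kernel scale add.commute[of "(h / 3) powr (p + 1)"])
  qed

  have "continuous_on {a..a + h} f"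
    using deriv by (intro DERIV_continuous_on)
  then have split: "integral {a..m} f + integral {m..a + h} f = integral {a..a + h} f"
    using h
    by (intro Henstock_Kurzweil_Integration.integral_combine integrable_continuous_interval)
      (auto simp: m_def)
  define E where "E = 1 / 6 * (f a + 4 * f m + f (a + h)) - 1 / h * integral {a..a + h} f"
  have "h * E = (h / 3 * f m + h / 6 * f a - integral {a..m} f)
      + (h / 6 * f (a + h) + h / 3 * f m - integral {m..a + h} f)"
    using h by (simp add: E_def flip: split) (simp add: field_simps)
  then have "h * \<bar>E\<bar> \<le> h\<^sup>2 * (K powr (1 / p) * (3 / 8 * A + 1 / 8 * B) powr (1 / q))
      + h\<^sup>2 * (K powr (1 / p) * (1 / 8 * A + 3 / 8 * B) powr (1 / q))"
    using left right h abs_mult[of h E] by linarith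
  also have "\<dots> = h * (h * K powr (1 / p)
      * ((3 / 8 * A + 1 / 8 * B) powr (1 / q) + (1 / 8 * A + 3 / 8 * B) powr (1 / q)))"
    by (simp add: power2_eq_square algebra_simps)
  finally show ?thesis
    using h by (simp add: E_def K_def m_def)
qed

theorem theorem2:
  fixes I :: "real set" and \<eta> :: "real \<Rightarrow> real \<Rightarrow> real"
    and f f' :: "real \<Rightarrow> real" and a b p q :: real
  assumes "open I"
    and "invex_wrt I \<eta>"
    and "abs_continuous_on I f"
    and "a \<in> I" and "b \<in> I" and "\<eta> b a \<noteq> 0"
    and "q > 1" and "p = q / (q - 1)"
    and "\<And>x. x \<in> I \<Longrightarrow> (f has_real_derivative f' x) (at x)"
    and "preinvex_on I \<eta> (\<lambda>x. \<bar>f' x\<bar> powr q)"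
  shows "\<bar>1 / 6 * (f a + 4 * f ((2 * a + \<eta> b a) / 2) + f (a + \<eta> b a))
            - 1 / \<eta> b a * integral {a..a + \<eta> b a} f\<bar>
    \<le> \<eta> b a * ((1 + 2 powr (p + 1)) / (6 powr (p + 1) * (p + 1))) powr (1 / p)
        * ((3 / 8 * \<bar>f' a\<bar> powr q + 1 / 8 * \<bar>f' b\<bar> powr q) powr (1 / q)
         + (1 / 8 * \<bar>f' a\<bar> powr q + 3 / 8 * \<bar>f' b\<bar> powr q) powr (1 / q))"
proof -
  let ?h = "\<eta> b a"
  have h: "?h > 0"
    using assms(2,4-6) unfolding invex_wrt_def by (simp add: less_le)
  have p: "p > 1"
    using assms(7,8) by (simp add: less_divide_eq)
  have pq: "1 / p + 1 / q = 1"
    using assms(7,8) by (simp add: diff_divide_distrib)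
  have "(2 * a + ?h) / 2 = a + ?h / 2"
    by simp
  moreover have "\<bar>1 / 6 * (f a + 4 * f (a + ?h / 2) + f (a + ?h)) - 1 / ?h * integral {a..a + ?h} f\<bar>
    \<le> ?h * ((1 + 2 powr (p + 1)) / (6 powr (p + 1) * (p + 1))) powr (1 / p)
       * ((3 / 8 * \<bar>f' a\<bar> powr q + 1 / 8 * \<bar>f' b\<bar> powr q) powr (1 / q)
        + (1 / 8 * \<bar>f' a\<bar> powr q + 3 / 8 * \<bar>f' b\<bar> powr q) powr (1 / q))"
  proof (rule Simpson_error_le_affine_bound[OF h p assms(7) pq])
    fix x assume x: "x \<in> {a..a + ?h}"
    note majorant = preinvex_on_le_affine[OF assms(10,4,5) h x]
    show "(f has_real_derivative f' x) (at x within {a..a + ?h})"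
      using assms(9)[OF majorant(1)] by (rule has_field_derivative_at_within)
    show "\<bar>f' x\<bar> powr q \<le> \<bar>f' a\<bar> powr q + (\<bar>f' b\<bar> powr q - \<bar>f' a\<bar> powr q) / ?h * (x - a)"
      by (rule majorant(2))
  qed simp_all
  ultimately show ?thesis
    by (simp only:)
qed

end
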